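(* Let $m>2$ be an even integer, $n\ge 1$ an integer, and let $M_{2mn}=\langle a,b : a^m=b^{2n}=1,\ bab^{-1}=a^{-1}\rangle$ be the metacyclic group of order $2mn$. Let $\Gamma_{M_{2mn}}$ be its non-commuting graph. Then the spectrum of the distance Laplacian matrix $D^L(\Gamma_{M_{2mn}})$ (eigenvalues counted with multiplicity, multiplicities being added if two of the listed values coincide) consists of: (a) $0$ with multiplicity $1$; (b) $2n(m-1)$ with multiplicity $\frac{m}{2}$; (c) $2mn$ with multiplicity $\frac{(2n-1)m}{2}$; (d) $(3m-4)n$ with multiplicity $\left(\frac{m}{2}-1\right)2n-1$.
   Context: For a finite non-abelian group $G$ with centre $Z(G)$, the non-commuting graph $\Gamma_G$ is the simple undirected graph with vertex set $G\setminus Z(G)$, in which two distinct vertices $u,v$ are adjacent if and only if $uv\ne vu$. For a connected graph $H$, $d_{uv}$ denotes the length of a shortest path between $u$ and $v$; the distance matrix $D(H)$ has $(u,v)$-entry $d_{uv}$. The transmission of a vertex $v$ is $\sum_{u} d_{uv}$, and $Tr(H)$ is the diagonal matrix of vertex transmissions. The distance Laplacian matrix is $D^L(H)=Tr(H)-D(H)$. *)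

theory Defs
  imports "Jordan_Normal_Form.Char_Poly" "HOL-Library.Product_Lexorder"
begin

definition grp_center :: "'g set \<Rightarrow> ('g \<Rightarrow> 'g \<Rightarrow> 'g) \<Rightarrow> 'g set" where
  "grp_center G gop = {z \<in> G. \<forall>g \<in> G. gop z g = gop g z}"

definition nc_vertices :: "'g set \<Rightarrow> ('g \<Rightarrow> 'g \<Rightarrow> 'g) \<Rightarrow> 'g set" where
  "nc_vertices G gop = G - grp_center G gop"

definition nc_adj :: "'g set \<Rightarrow> ('g \<Rightarrow> 'g \<Rightarrow> 'g) \<Rightarrow> 'g \<Rightarrow> 'g \<Rightarrow> bool" where
  "nc_adj G gop u v \<longleftrightarrow> u \<in> nc_vertices G gop \<and> v \<in> nc_vertices G gop \<and> u \<noteq> v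
      \<and> gop u v \<noteq> gop v u"

definition is_walk :: "'a set \<Rightarrow> ('a \<Rightarrow> 'a \<Rightarrow> bool) \<Rightarrow> 'a list \<Rightarrow> 'a \<Rightarrow> 'a \<Rightarrow> bool" where
  "is_walk V E xs u v \<longleftrightarrow> xs \<noteq> [] \<and> hd xs = u \<and> last xs = v \<and> set xs \<subseteq> V
      \<and> (\<forall>i. Suc i < length xs \<longrightarrow> E (xs ! i) (xs ! Suc i))"

text \<open>Distance: length of a shortest walk (the graphs considered are connected).\<close>
definition graph_dist :: "'a set \<Rightarrow> ('a \<Rightarrow> 'a \<Rightarrow> bool) \<Rightarrow> 'a \<Rightarrow> 'a \<Rightarrow> nat" where
  "graph_dist V E u v = (LEAST k. \<exists>xs. is_walk V E xs u v \<and> length xs = Suc k)"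

definition transmission :: "'a set \<Rightarrow> ('a \<Rightarrow> 'a \<Rightarrow> bool) \<Rightarrow> 'a \<Rightarrow> nat" where
  "transmission V E v = (\<Sum>u\<in>V. graph_dist V E u v)"

definition dist_laplacian :: "'a set \<Rightarrow> ('a \<Rightarrow> 'a \<Rightarrow> bool) \<Rightarrow> 'a \<Rightarrow> 'a \<Rightarrow> real" where
  "dist_laplacian V E u v =
     (if u = v then real (transmission V E v) else 0) - real (graph_dist V E u v)"

text \<open>As a matrix, indexing V (finite, linearly ordered) by its sorted enumeration.
  The characteristic polynomial does not depend on the enumeration.\<close>
definition dist_laplacian_mat :: "'a::linorder set \<Rightarrow> ('a \<Rightarrow> 'a \<Rightarrow> bool) \<Rightarrow> real mat" where
  "dist_laplacian_mat V E =
     (let vs = sorted_list_of_set V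
      in mat (length vs) (length vs) (\<lambda>(i, j). dist_laplacian V E (vs ! i) (vs ! j)))"

text \<open>Metacyclic group M_{2mn} = <a,b | a^m = b^(2n) = 1, b a b^-1 = a^-1>:
  element (i,j) stands for a^i b^j with 0 \<le> i < m, 0 \<le> j < 2n; since b^j a^i = a^((-1)^j i) b^j,
  (i1,j1)(i2,j2) = (i1 + (-1)^j1 i2 mod m, j1 + j2 mod 2n).\<close>
definition metacyclic_carrier :: "nat \<Rightarrow> nat \<Rightarrow> (nat \<times> nat) set" where
  "metacyclic_carrier m n = {0..<m} \<times> {0..<2 * n}"

definition metacyclic_mult :: "nat \<Rightarrow> nat \<Rightarrow> nat \<times> nat \<Rightarrow> nat \<times> nat \<Rightarrow> nat \<times> nat" where
  "metacyclic_mult m n x y =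
     (let (i1, j1) = x; (i2, j2) = y
      in (nat ((int i1 + (-1) ^ j1 * int i2) mod int m), (j1 + j2) mod (2 * n)))"

end

theory Submission
  imports Defs
begin

text \<open>Commuting is an equivalence relation on the non-central elements of the metacyclic group, so
  the non-commuting graph is complete multipartite.  In a complete multipartite graph on \<open>N\<close>
  vertices all distances are \<open>1\<close> between parts and \<open>2\<close> within a part; hence a difference of two
  unit vectors in a part of size \<open>s\<close> is an eigenvector of the distance Laplacian for \<open>N + s\<close>,
  and on the span of the indicators of the parts the eigenvalues are \<open>0\<close> (all-ones vector)
  and \<open>N\<close>.\<close>

section \<open>Distances in a complete multipartite graph\<close>

lemma graph_dist_self:
  assumes "u \<in> V"
  shows "graph_dist V E u u = 0"
proof -
  have "is_walk V E [u] u u"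
    using assms by (simp add: is_walk_def)
  then have "\<exists>xs. is_walk V E xs u u \<and> length xs = Suc 0"
    by (metis One_nat_def length_Cons list.size(3))
  then show ?thesis
    unfolding graph_dist_def by (intro Least_eq_0) auto
qed

lemma graph_dist_adjacent:
  assumes "u \<in> V" "v \<in> V" "u \<noteq> v" "E u v"
  shows "graph_dist V E u v = 1"
  unfolding graph_dist_def
proof (rule Least_equality)
  have "is_walk V E [u, v] u v"
    using assms by (simp add: is_walk_def)
  then show "\<exists>xs. is_walk V E xs u v \<and> length xs = Suc 1"
    by (intro exI[of _ "[u, v]"]) simp
next
  fix k assume "\<exists>xs. is_walk V E xs u v \<and> length xs = Suc k"
  then obtain xs where xs: "is_walk V E xs u v" "length xs = Suc k" by blast
  then have "k \<noteq> 0"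
    using \<open>u \<noteq> v\<close> by (auto simp: is_walk_def length_Suc_conv)
  then show "1 \<le> k" by simp
qed

lemma graph_dist_common_neighbour:
  assumes "u \<in> V" "v \<in> V" "w \<in> V" "u \<noteq> v" "\<not> E u v" "E u w" "E w v"
  shows "graph_dist V E u v = 2"
  unfolding graph_dist_def
proof (rule Least_equality)
  have "is_walk V E [u, w, v] u v"
    using assms by (auto simp: is_walk_def less_Suc_eq)
  then show "\<exists>xs. is_walk V E xs u v \<and> length xs = Suc 2"
    by (intro exI[of _ "[u, w, v]"]) simp
next
  fix k assume "\<exists>xs. is_walk V E xs u v \<and> length xs = Suc k"
  then obtain xs where xs: "is_walk V E xs u v" "length xs = Suc k" by blast
  have "k \<noteq> 0"
    using xs \<open>u \<noteq> v\<close> by (auto simp: is_walk_def length_Suc_conv)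
  moreover have "k \<noteq> 1"
    using xs \<open>\<not> E u v\<close> by (auto simp: is_walk_def length_Suc_conv)
  ultimately show "2 \<le> k" by simp
qed

definition class_size :: "'a set \<Rightarrow> ('a \<Rightarrow> 'b) \<Rightarrow> 'b \<Rightarrow> nat" where
  "class_size V c C = card {v \<in> V. c v = C}"

text \<open>With at least two classes, every vertex has some \<open>w\<close> outside its class, and
  \<open>w\<close> is a common neighbour of any two vertices inside the class, so distances never
  exceed 2. A vertex in a class of size \<open>s\<close> therefore has transmission
  \<open>card V + s - 2\<close>; the 2 is hidden in the two subtractions, both of which apply on the
  diagonal.\<close>

lemma dist_laplacian_complete_multipartite:
  assumes "finite V" and E: "\<And>u v. u \<in> V \<Longrightarrow> v \<in> V \<Longrightarrow> E u v \<longleftrightarrow> c u \<noteq> c v"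
    and two: "card (c ` V) \<ge> 2" and "u \<in> V" "v \<in> V"
  shows "dist_laplacian V E u v =
    (if u = v then real (card V + class_size V c (c u)) else 0) - 1 - (if c u = c v then 1 else 0)"
proof -
  \<comment> \<open>The three cases are folded into one sum (at \<open>x = y\<close> it reads 1 + 1
    - 2), so that the transmission can be summed term by term.\<close>
  have dist: "real (graph_dist V E x y) =
      1 + (if c x = c y then 1 else 0) - (if x = y then 2 else 0)" if "x \<in> V" "y \<in> V" for x y
  proof -
    have "\<exists>w\<in>V. c w \<noteq> c x"
    proof (rule ccontr)
      assume "\<not> ?thesis"
      then have "c ` V \<subseteq> {c x}" by auto
      then have "card (c ` V) \<le> 1" using card_mono[of "{c x}" "c ` V"] by simp
      with two show False by simp
    qed
    then obtain w where "w \<in> V" "c w \<noteq> c x" by blast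
    then show ?thesis
      using that E graph_dist_self[of x V E] graph_dist_adjacent[of x V y E]
        graph_dist_common_neighbour[of x V y w E]
      by (cases "x = y"; cases "c x = c y") auto
  qed
  have "real (transmission V E u) =
      (\<Sum>x\<in>V. 1 + (if c x = c u then 1 else 0) - (if x = u then 2 else 0))"
    unfolding transmission_def using dist \<open>u \<in> V\<close> by simp
  also have "\<dots> = real (card V) + real (class_size V c (c u)) - 2"
    using \<open>finite V\<close> \<open>u \<in> V\<close>
    by (simp add: sum.distrib sum_subtractf class_size_def sum.If_cases Int_def)
  finally show ?thesis
    using dist[OF \<open>u \<in> V\<close> \<open>v \<in> V\<close>] by (auto simp: dist_laplacian_def)
qed

section \<open>The spectrum of a complete multipartite distance Laplacian\<close>

text \<open>The same matrix with the vertices renamed to \<open>0, ..., N - 1\<close>, so that each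
  class has a least index to serve as its representative.\<close>

definition multipartite_laplacian :: "nat \<Rightarrow> (nat \<Rightarrow> 'b) \<Rightarrow> real mat" where
  "multipartite_laplacian N c = mat N N (\<lambda>(i, j).
     (if i = j then real (N + class_size {..<N} c (c i)) else 0) - 1 - (if c i = c j then 1 else 0))"

text \<open>An eigenbasis up to one triangular correction, with the least index of each class as its
  representative: \<open>e\<^sub>j - e\<^sub>r\<close> for \<open>j\<close> not a representative and \<open>r\<close> the representative of its
  class, the indicator of the class of \<open>j\<close> for a representative \<open>j \<noteq> 0\<close>, and the all-ones
  vector for \<open>j = 0\<close>.  On an indicator \<open>v\<close> of a class of size \<open>s\<close> the matrix acts by
  \<open>N v - s 1\<close>, so the only entries off the diagonal are in row \<open>0\<close>.\<close>
lemma multipartite_laplacian_similar: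
  fixes c :: "nat \<Rightarrow> 'b"
  assumes "0 < N"
  defines "s \<equiv> \<lambda>i. real (class_size {..<N} c (c i))"
    and "rep \<equiv> \<lambda>i. LEAST k. c k = c i"
  shows "similar_mat (multipartite_laplacian N c) (mat N N (\<lambda>(i, j).
     if i = j then (if i = 0 then 0 else if rep i = i then N else N + s i)
     else if i = 0 \<and> rep j = j then - s j else 0))"
    (is "similar_mat ?M ?T")
proof -
  have rep_c: "c (rep i) = c i" for i
    unfolding rep_def by (rule LeastI) (rule refl)
  have rep_le: "rep i \<le> i" for i
    unfolding rep_def by (rule Least_le) (rule refl)
  have rep_cong: "rep i = rep j" if "c i = c j" for i j
    using that by (simp add: rep_def)
  have rep_0: "rep 0 = 0"
    using rep_le[of 0] by simp
  have rep_less: "rep i < N" if "i < N" for i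
    using rep_le[of i] that by simp
  have s_cong: "s i = s j" if "c i = c j" for i j
    using that by (simp add: s_def)
  have s_pos: "s i > 0" if "i < N" for i
    using that by (auto simp: s_def class_size_def card_gt_0_iff)
  have s_sum: "(\<Sum>k<N. of_bool (c k = c i)) = s i" for i
    by (simp add: s_def class_size_def Int_def flip: sum.inter_filter)

  define P :: "nat \<Rightarrow> nat \<Rightarrow> real" where
    "P i j = (if j = 0 then 1 else if rep j = j then of_bool (c i = c j)
      else of_bool (i = j) - of_bool (i = rep j))" for i j
  \<comment> \<open>Row \<open>i\<close> of \<open>Q\<close> reads off coordinate \<open>i\<close>
    of a vector \<open>x\<close> in the basis given by the columns of \<open>P\<close>: the
    deviation of \<open>x i\<close> from its class mean for a non-representative, the mean over the
    class of 0 for \<open>i = 0\<close>, and the difference between the mean of the class of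
    \<open>i\<close> and that of the class of 0 for any other representative.\<close>
  define Q :: "nat \<Rightarrow> nat \<Rightarrow> real" where
    "Q i j = (if rep i \<noteq> i then of_bool (i = j) - of_bool (c j = c i) / s i
      else if i = 0 then of_bool (c j = c 0) / s 0
      else of_bool (c j = c i) / s i - of_bool (c j = c 0) / s 0)" for i j
  define tr :: "nat \<Rightarrow> nat \<Rightarrow> real" where
    "tr i j = (if i = j then (if i = 0 then 0 else if rep i = i then N else N + s i)
     else if i = 0 \<and> rep j = j then - s j else 0)" for i j

  have pick: "(\<Sum>k<N. of_bool (k = i) * f k) = f i" if "i < N" for i and f :: "nat \<Rightarrow> real"
    using that by (simp add: of_bool_def if_distrib[of "\<lambda>x. x * _"] cong: if_cong)
  \<comment> \<open>Both \<open>Q\<close> and the matrix itself act on a column of \<open>P\<close>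
    through its entries and its sums over classes. For a difference of unit vectors such a sum
    vanishes, because \<open>j\<close> and \<open>rep j\<close> lie in the same class and
    cancel.\<close>
  have class_sum: "(\<Sum>k<N. of_bool (c k = c i) * P k j) =
      (if j = 0 then s i else if rep j = j then s i * of_bool (c i = c j) else 0)"
    if "i < N" "j < N" for i j
  proof -
    consider "j = 0" | "j \<noteq> 0" "rep j = j" | "j \<noteq> 0" "rep j \<noteq> j" by blast
    then show ?thesis
    proof cases
      case 1
      then show ?thesis using s_sum[of i] by (simp add: P_def)
    next
      case 2
      have "(\<Sum>k<N. of_bool (c k = c i) * P k j)
          = (\<Sum>k<N. of_bool (c k = c i) * of_bool (c i = c j))"
        using 2 by (intro sum.cong) (auto simp: P_def)
      also have "\<dots> = s i * of_bool (c i = c j)"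
        using s_sum[of i] by (simp flip: sum_distrib_right)
      finally show ?thesis using 2 by simp
    next
      case 3
      have "(\<Sum>k<N. of_bool (c k = c i) * P k j)
          = (\<Sum>k<N. of_bool (k = j) * of_bool (c k = c i))
            - (\<Sum>k<N. of_bool (k = rep j) * of_bool (c k = c i))"
        unfolding sum_subtractf[symmetric]
        using 3 by (intro sum.cong) (auto simp: P_def)
      also have "\<dots> = 0"
        using pick that rep_less rep_c by simp
      finally show ?thesis using 3 by simp
    qed
  qed
  have total: "(\<Sum>k<N. P k j) = (if j = 0 then N else if rep j = j then s j else 0)"
    if "j < N" for j
  proof (cases "j = 0 \<or> rep j = j")
    case True
    then show ?thesis
      using s_sum[of j] by (auto simp: P_def)
  next
    case False
    then have "(\<Sum>k<N. P k j)
        = (\<Sum>k<N. of_bool (k = j) * 1) - (\<Sum>k<N. of_bool (k = rep j) * 1)"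
      unfolding sum_subtractf[symmetric] by (intro sum.cong) (auto simp: P_def)
    also have "\<dots> = 0"
      using pick[of j "\<lambda>_. 1"] pick[of "rep j" "\<lambda>_. 1"] that rep_less by simp
    finally show ?thesis using False by simp
  qed

  have QP: "(\<Sum>k<N. Q i k * P k j) = of_bool (i = j)" if "i < N" "j < N" for i j
  proof -
    have same: "of_bool (i = k) = (of_bool (k = i) :: real)" for k by auto
    consider "rep i \<noteq> i" | "rep i = i" "i = 0" | "rep i = i" "i \<noteq> 0" by blast
    then show ?thesis
    proof cases
      case 1
      then have "(\<Sum>k<N. Q i k * P k j) =
          (\<Sum>k<N. of_bool (k = i) * P k j) - (\<Sum>k<N. of_bool (c k = c i) * P k j) / s i"
        by (simp add: Q_def same left_diff_distrib sum_subtractf sum_divide_distrib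
            del: sum_of_bool_mult_eq)
      also have "\<dots> = P i j
          - (if j = 0 then s i else if rep j = j then s i * of_bool (c i = c j) else 0) / s i"
        by (simp only: pick[OF that(1)] class_sum[OF that])
      also have "\<dots> = of_bool (i = j)"
        using 1 s_pos[OF that(1)] rep_0 rep_cong[OF rep_c[of j]]
        by (cases "i = 0") (auto simp: P_def)
      finally show ?thesis .
    next
      case 2
      then have "(\<Sum>k<N. Q i k * P k j) = (\<Sum>k<N. of_bool (c k = c 0) * P k j) / s 0"
        by (simp add: Q_def sum_divide_distrib del: sum_of_bool_mult_eq)
      also have "\<dots> = of_bool (i = j)"
        using 2 s_pos[of 0] that rep_0 rep_cong[of 0 j] by (auto simp: class_sum simp del: sum_of_bool_mult_eq)
      finally show ?thesis .
    next
      case 3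
      then have "(\<Sum>k<N. Q i k * P k j) = (\<Sum>k<N. of_bool (c k = c i) * P k j) / s i
          - (\<Sum>k<N. of_bool (c k = c 0) * P k j) / s 0"
        by (simp add: Q_def left_diff_distrib sum_subtractf sum_divide_distrib
            del: sum_of_bool_mult_eq)
      also have "\<dots> =
          (if j = 0 then s i else if rep j = j then s i * of_bool (c i = c j) else 0) / s i
          - (if j = 0 then s 0 else if rep j = j then s 0 * of_bool (c 0 = c j) else 0) / s 0"
        by (simp only: class_sum[OF that] class_sum[OF \<open>0 < N\<close> that(2)])
      also have "\<dots> = of_bool (i = j)"
      proof -
        have "c 0 \<noteq> c j" if "j \<noteq> 0" "rep j = j"
          using rep_cong[of 0 j] rep_0 that by auto
        moreover have "c i = c j \<longleftrightarrow> i = j" if "rep j = j"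
          using rep_cong[of i j] 3 that by auto
        moreover have "s 0 \<noteq> 0" "s i \<noteq> 0"
          using s_pos[OF \<open>0 < N\<close>] s_pos[OF that(1)] by simp_all
        ultimately show ?thesis
          using 3 by (cases "j = 0"; cases "rep j = j") auto
      qed
      finally show ?thesis .
    qed
  qed

  \<comment> \<open>The intertwining relation, matrix times \<open>P\<close> equals \<open>P\<close>
    times \<open>tr\<close>, written entrywise.\<close>
  have MP: "(\<Sum>k<N. ((if i = k then N + s i else 0) - 1 - (if c i = c k then 1 else 0)) * P k j)
      = (\<Sum>k<N. P i k * tr k j)" if "i < N" "j < N" for i j
  proof -
    have "(\<Sum>k<N. ((if i = k then N + s i else 0) - 1 - (if c i = c k then 1 else 0)) * P k j)
        = (\<Sum>k<N. of_bool (k = i) * ((N + s i) * P k j) - P k j - of_bool (c k = c i) * P k j)"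
      by (intro sum.cong) (auto simp: algebra_simps)
    also have "\<dots> = (N + s i) * P i j - (\<Sum>k<N. P k j) - (\<Sum>k<N. of_bool (c k = c i) * P k j)"
      using pick[of i "\<lambda>k. (N + s i) * P k j"] that by (simp add: sum_subtractf)
    also have "\<dots> = (N + s i) * P i j - (if j = 0 then N else if rep j = j then s j else 0)
        - (if j = 0 then s i else if rep j = j then s i * of_bool (c i = c j) else 0)"
      by (simp only: total[OF that(2)] class_sum[OF that])
    \<comment> \<open>Column \<open>j\<close> of \<open>tr\<close> has nonzero entries at most in
      rows 0 and \<open>j\<close>, and column 0 of \<open>P\<close> is all ones. If \<open>j\<close>
      is not a representative, \<open>P i j\<close> vanishes unless \<open>c i = c j\<close>, which
      is why \<open>s i\<close> may be replaced by \<open>s j\<close>.\<close>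
    also have "\<dots> = of_bool (j \<noteq> 0) * tr 0 j + P i j * tr j j"
      using s_cong[of i j] s_cong[of "rep j" j] rep_c[of j]
      by (auto simp: tr_def P_def algebra_simps)
    also have "\<dots> = (\<Sum>k<N. of_bool (k = 0) * (of_bool (j \<noteq> 0) * tr 0 j)
        + of_bool (k = j) * (P i k * tr k j))"
      using pick[of 0 "\<lambda>k. of_bool (j \<noteq> 0) * tr 0 j"] pick[of j "\<lambda>k. P i k * tr k j"] that
      by (simp add: sum.distrib)
    also have "\<dots> = (\<Sum>k<N. P i k * tr k j)"
      by (intro sum.cong) (auto simp: tr_def P_def)
    finally show ?thesis .
  qed

  define A where "A = mat N N (\<lambda>(i, j). P i j)"
  define B where "B = mat N N (\<lambda>(i, j). Q i j)"
  have T: "?T = mat N N (\<lambda>(i, j). tr i j)"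
    unfolding tr_def by simp
  have carrier: "A \<in> carrier_mat N N" "B \<in> carrier_mat N N" "?M \<in> carrier_mat N N"
    "?T \<in> carrier_mat N N"
    by (auto simp: A_def B_def multipartite_laplacian_def)
  have entry: "(X * Y) $$ (i, j) = (\<Sum>k<N. X $$ (i, k) * Y $$ (k, j))"
    if "X \<in> carrier_mat N N" "Y \<in> carrier_mat N N" "i < N" "j < N"
    for X Y :: "real mat" and i j
    using that by (auto simp: scalar_prod_def lessThan_atLeast0)
  have BA: "B * A = 1\<^sub>m N"
    using QP by (auto simp: A_def B_def scalar_prod_def lessThan_atLeast0 intro!: eq_matI)
  have AB: "A * B = 1\<^sub>m N"
    using mat_mult_left_right_inverse[OF carrier(2,1) BA] .
  have "?M * A = A * ?T"
  proof (rule eq_matI)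
    fix i j assume "i < dim_row (A * ?T)" "j < dim_col (A * ?T)"
    then have ij: "i < N" "j < N" by (simp_all add: A_def)
    have "(?M * A) $$ (i, j) = (\<Sum>k<N. ?M $$ (i, k) * A $$ (k, j))"
      using entry[OF carrier(3,1) ij] .
    also have "\<dots> = (\<Sum>k<N. ((if i = k then N + s i else 0) - 1
        - (if c i = c k then 1 else 0)) * P k j)"
      using ij by (intro sum.cong) (auto simp: multipartite_laplacian_def A_def s_def)
    also have "\<dots> = (\<Sum>k<N. P i k * tr k j)"
      using MP[OF ij] .
    also have "\<dots> = (\<Sum>k<N. A $$ (i, k) * ?T $$ (k, j))"
      unfolding T using ij by (intro sum.cong) (auto simp: A_def)
    also have "\<dots> = (A * ?T) $$ (i, j)"
      using entry[OF carrier(1,4) ij] by (rule sym)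
    finally show "(?M * A) $$ (i, j) = (A * ?T) $$ (i, j)" .
  qed (simp_all add: A_def multipartite_laplacian_def)
  then have "A * ?T * B = ?M * (A * B)"
    using assoc_mult_mat[OF carrier(3,1,2)] by simp
  then have M: "?M = A * ?T * B"
    unfolding AB using right_mult_one_mat[OF carrier(3)] by simp
  show ?thesis
    by (rule similar_matI[OF _ AB BA M]) (use carrier in blast)
qed

text \<open>The similar triangular matrix shows its eigenvalues on the diagonal. Representatives
  correspond bijectively to classes: index 0 gives the eigenvalue 0 and the others give
  \<open>N\<close>. Removing its representative leaves a class of size \<open>s\<close> with
  \<open>s - 1\<close> indices, each contributing \<open>N + s\<close>.\<close>

lemma char_poly_multipartite_laplacian:
  fixes c :: "nat \<Rightarrow> 'b"
  assumes "0 < N"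
  shows "char_poly (multipartite_laplacian N c) =
    [:0, 1:] * [:- real N, 1:] ^ (card (c ` {..<N}) - 1)
    * (\<Prod>C\<in>c ` {..<N}. [:- real (N + class_size {..<N} c C), 1:] ^ (class_size {..<N} c C - 1))"
proof -
  define s where "s = (\<lambda>i. real (class_size {..<N} c (c i)))"
  define rep where "rep = (\<lambda>i. LEAST k. c k = c i)"
  define d where "d i = (if i = 0 then 0 else if rep i = i then N else N + s i)" for i
  define T where "T = mat N N (\<lambda>(i, j). if i = j then d i
     else if i = 0 \<and> rep j = j then - s j else 0)"
  define R where "R = {i \<in> {..<N}. rep i = i}"
  have rep_c: "c (rep i) = c i" for i
    unfolding rep_def by (rule LeastI) (rule refl)
  have rep_le: "rep i \<le> i" for i
    unfolding rep_def by (rule Least_le) (rule refl)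
  have rep_cong: "rep i = rep j" if "c i = c j" for i j
    using that by (simp add: rep_def)
  have rep_in: "rep i \<in> R" if "i < N" for i
    using rep_le[of i] that rep_cong[OF rep_c[of i]] by (auto simp: R_def)
  have "0 \<in> R" using rep_le[of 0] \<open>0 < N\<close> by (simp add: R_def)
  have "inj_on c R"
  proof (rule inj_onI)
    fix i j assume "i \<in> R" "j \<in> R" "c i = c j"
    then show "i = j"
      using rep_cong[of i j] by (simp add: R_def)
  qed
  moreover have image_R: "c ` R = c ` {..<N}"
  proof
    show "c ` {..<N} \<subseteq> c ` R"
      using rep_in rep_c by (metis image_subset_iff imageI lessThan_iff)
  qed (auto simp: R_def)
  ultimately have card_R: "card R = card (c ` {..<N})"
    by (metis card_image)
  have "similar_mat (multipartite_laplacian N c) T"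
    unfolding T_def d_def s_def rep_def
    by (rule multipartite_laplacian_similar[OF \<open>0 < N\<close>])
  then have "char_poly (multipartite_laplacian N c) = char_poly T"
    by (rule char_poly_similar)
  also have "\<dots> = (\<Prod>a\<leftarrow>diag_mat T. [:- a, 1:])"
    by (rule char_poly_upper_triangular[of _ N]) (auto simp: T_def)
  also have "\<dots> = (\<Prod>i<N. [:- d i, 1:])"
  proof -
    have "map (\<lambda>a. [:- a, 1:]) (diag_mat T) = map (\<lambda>i. [:- d i, 1:]) [0..<N]"
      by (simp add: diag_mat_def T_def)
    then show ?thesis
      using prod.distinct_set_conv_list[of "[0..<N]" "\<lambda>i. [:- d i, 1:]"]
      by (simp add: lessThan_atLeast0)
  qed
  also have "\<dots> = (\<Prod>i\<in>R. [:- d i, 1:]) * (\<Prod>i\<in>{..<N} - R. [:- d i, 1:])"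
    by (subst prod.subset_diff[of R]) (auto simp: R_def mult.commute)
  also have "(\<Prod>i\<in>R. [:- d i, 1:]) = [:0, 1:] * (\<Prod>i\<in>R - {0}. [:- real N, 1:])"
    using \<open>0 \<in> R\<close>
    by (subst prod.remove[of R 0]) (auto simp: R_def d_def intro!: prod.cong)
  also have "\<dots> = [:0, 1:] * [:- real N, 1:] ^ (card (c ` {..<N}) - 1)"
    using \<open>0 \<in> R\<close> card_R by simp
  also have "(\<Prod>i\<in>{..<N} - R. [:- d i, 1:])
      = (\<Prod>C\<in>c ` {..<N}. \<Prod>i\<in>{i \<in> {..<N} - R. c i = C}. [:- d i, 1:])"
    by (rule prod.group[symmetric]) auto
  also have "\<dots> = (\<Prod>C\<in>c ` {..<N}.
      [:- real (N + class_size {..<N} c C), 1:] ^ (class_size {..<N} c C - 1))"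
  proof (rule prod.cong[OF refl])
    fix C assume "C \<in> c ` {..<N}"
    then obtain r where r: "r \<in> R" "c r = C"
      using image_R by (metis imageE)
    then have "{i \<in> {..<N} - R. c i = C} = {i \<in> {..<N}. c i = C} - {r}"
      using \<open>inj_on c R\<close> by (auto simp: inj_on_def)
    moreover have "r \<in> {i \<in> {..<N}. c i = C}"
      using r by (auto simp: R_def)
    ultimately have "card {i \<in> {..<N} - R. c i = C} = class_size {..<N} c C - 1"
      by (simp add: class_size_def)
    \<comment> \<open>Index 0 is a representative, so the exceptional diagonal entry
      \<open>d 0\<close> cannot occur among these factors.\<close>
    moreover have "(\<Prod>i\<in>{i \<in> {..<N} - R. c i = C}. [:- d i, 1:]) =
        (\<Prod>i\<in>{i \<in> {..<N} - R. c i = C}. [:- real (N + class_size {..<N} c C), 1:])"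
      using \<open>0 \<in> R\<close> by (intro prod.cong) (auto simp: d_def R_def s_def intro: gr0I)
    ultimately show "(\<Prod>i\<in>{i \<in> {..<N} - R. c i = C}. [:- d i, 1:]) =
        [:- real (N + class_size {..<N} c C), 1:] ^ (class_size {..<N} c C - 1)"
      by simp
  qed
  finally show ?thesis .
qed

text \<open>The sorted enumeration is a bijection from \<open>{..<N}\<close> onto \<open>V\<close>;
  pulling the colouring back along it preserves the set of classes and their sizes.\<close>

lemma char_poly_dist_laplacian_complete_multipartite:
  fixes V :: "'a::linorder set"
  assumes "finite V" and E: "\<And>u v. u \<in> V \<Longrightarrow> v \<in> V \<Longrightarrow> E u v \<longleftrightarrow> c u \<noteq> c v"
    and two: "card (c ` V) \<ge> 2"
  shows "char_poly (dist_laplacian_mat V E) =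
    [:0, 1:] * [:- real (card V), 1:] ^ (card (c ` V) - 1)
    * (\<Prod>C\<in>c ` V. [:- real (card V + class_size V c C), 1:] ^ (class_size V c C - 1))"
proof -
  define vs where "vs = sorted_list_of_set V"
  define N where "N = card V"
  have len: "length vs = N"
    by (simp add: vs_def N_def)
  have bij: "bij_betw ((!) vs) {..<N} V"
    unfolding vs_def using \<open>finite V\<close>
    by (intro bij_betw_nth) (simp_all add: N_def)
  then have in_V: "vs ! i \<in> V" if "i < N" for i
    using that by (auto simp: bij_betw_def)
  have nth_eq: "vs ! i = vs ! j \<longleftrightarrow> i = j" if "i < N" "j < N" for i j
    using bij that by (auto simp: bij_betw_def inj_on_def)
  define c' where "c' i = c (vs ! i)" for i
  have image: "c' ` {..<N} = c ` V"
    using bij by (force simp: c'_def bij_betw_def)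
  have size: "class_size {..<N} c' C = class_size V c C" for C
  proof -
    have "bij_betw ((!) vs) {k \<in> {..<N}. c' k = C} {v \<in> V. c v = C}"
      using bij by (rule bij_betw_Collect) (simp add: c'_def)
    then show ?thesis
      by (simp add: class_size_def bij_betw_same_card)
  qed
  have "0 < N"
    using two \<open>finite V\<close> by (auto simp: N_def card_gt_0_iff)
  have "dist_laplacian_mat V E = multipartite_laplacian N c'"
    unfolding dist_laplacian_mat_def multipartite_laplacian_def Let_def vs_def[symmetric] len
    using dist_laplacian_complete_multipartite[OF assms in_V in_V] nth_eq
    by (intro cong_mat) (auto simp: size simp flip: c'_def N_def)
  then show ?thesis
    unfolding N_def[symmetric]
    using char_poly_multipartite_laplacian[OF \<open>0 < N\<close>, of c', unfolded image size] by simp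
qed

section \<open>Centre and commutation in the metacyclic group\<close>

lemma neg_one_power_parity: "(-1 :: int) ^ j = (if even j then 1 else -1)"
  by (simp add: minus_one_power_iff)

text \<open>The exponents of \<open>b\<close> always agree, so only those of \<open>a\<close> are
  compared modulo \<open>m\<close>. Grouping their difference by \<open>i\<close> and
  \<open>k\<close> leaves coefficients that are 0 or 2 according to parity.\<close>

lemma metacyclic_commute_iff:
  assumes "(i, j) \<in> metacyclic_carrier m n" "(k, l) \<in> metacyclic_carrier m n"
  shows "metacyclic_mult m n (i, j) (k, l) = metacyclic_mult m n (k, l) (i, j) \<longleftrightarrow>
    int m dvd (1 - (-1) ^ l) * int i - (1 - (-1) ^ j) * int k"
proof -
  have "0 < m" using assms by (auto simp: metacyclic_carrier_def)
  then have "metacyclic_mult m n (i, j) (k, l) = metacyclic_mult m n (k, l) (i, j) \<longleftrightarrow>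
      (int i + (-1) ^ j * int k) mod int m = (int k + (-1) ^ l * int i) mod int m"
    by (simp add: metacyclic_mult_def eq_nat_nat_iff add.commute)
  also have "\<dots> \<longleftrightarrow> int m dvd (int i + (-1) ^ j * int k) - (int k + (-1) ^ l * int i)"
    by (rule mod_eq_dvd_iff)
  finally show ?thesis
    by (simp add: algebra_simps)
qed

text \<open>Testing against \<open>a = (1, 0)\<close> forces \<open>j\<close> to be even, since
  \<open>m > 2\<close> does not divide 2; testing against \<open>b = (0, 1)\<close> gives that
  \<open>m\<close> divides \<open>2 * i\<close>. Conversely, these two conditions make the
  commutation criterion hold for every element.\<close>

lemma mem_grp_center_metacyclic_iff:
  assumes "m = 2 * h" "h > 1" "n \<ge> 1"
  shows "(i, j) \<in> grp_center (metacyclic_carrier m n) (metacyclic_mult m n) \<longleftrightarrow>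
    (i, j) \<in> metacyclic_carrier m n \<and> even j \<and> h dvd i"
proof
  assume "(i, j) \<in> grp_center (metacyclic_carrier m n) (metacyclic_mult m n)"
  then have ij: "(i, j) \<in> metacyclic_carrier m n"
    and comm: "\<And>x. x \<in> metacyclic_carrier m n \<Longrightarrow>
      metacyclic_mult m n (i, j) x = metacyclic_mult m n x (i, j)"
    by (auto simp: grp_center_def)
  have "(1, 0) \<in> metacyclic_carrier m n" "(0, 1) \<in> metacyclic_carrier m n"
    using assms by (auto simp: metacyclic_carrier_def)
  then have "int m dvd - (1 - (-1) ^ j)" "int m dvd 2 * int i"
    using comm ij by (force simp: metacyclic_commute_iff)+
  moreover have "\<not> int m dvd - 2"
    using assms zdvd_imp_le[of "int m" 2] by auto
  ultimately show "(i, j) \<in> metacyclic_carrier m n \<and> even j \<and> h dvd i"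
    using ij assms by (auto simp: neg_one_power_parity split: if_splits)
next
  assume ij: "(i, j) \<in> metacyclic_carrier m n \<and> even j \<and> h dvd i"
  then have "int m dvd 2 * int i"
    using assms by auto
  then show "(i, j) \<in> grp_center (metacyclic_carrier m n) (metacyclic_mult m n)"
    using ij by (auto simp: grp_center_def metacyclic_commute_iff neg_one_power_parity)
qed

text \<open>The parts of the complete multipartite graph are the non-central elements with even
  \<open>b\<close>-exponent, and for each \<open>i < m / 2\<close> the elements with odd \<open>b\<close>-exponent and
  \<open>a\<close>-exponent \<open>i\<close> or \<open>i + m / 2\<close>.\<close>
definition metacyclic_part :: "nat \<Rightarrow> nat \<times> nat \<Rightarrow> nat option" where
  "metacyclic_part h = (\<lambda>(i, j). if even j then None else Some (i mod h))"

text \<open>Two even \<open>b\<close>-exponents always commute, and two odd ones commute exactly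
  when \<open>h\<close> divides \<open>i - k\<close>. With mixed parity, commuting would require
  \<open>h\<close> to divide the \<open>a\<close>-exponent of the element with even
  \<open>b\<close>-exponent, which would make that element central.\<close>

lemma nc_adj_metacyclic_iff:
  assumes "m = 2 * h" "h > 1" "n \<ge> 1"
    and "u \<in> nc_vertices (metacyclic_carrier m n) (metacyclic_mult m n)"
    and "v \<in> nc_vertices (metacyclic_carrier m n) (metacyclic_mult m n)"
  shows "nc_adj (metacyclic_carrier m n) (metacyclic_mult m n) u v
    \<longleftrightarrow> metacyclic_part h u \<noteq> metacyclic_part h v"
proof -
  obtain i j k l where uv: "u = (i, j)" "v = (k, l)"
    by (cases u, cases v)
  have in_G: "(i, j) \<in> metacyclic_carrier m n" "(k, l) \<in> metacyclic_carrier m n"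
    and nc: "even j \<Longrightarrow> \<not> h dvd i" "even l \<Longrightarrow> \<not> h dvd k"
    using assms uv mem_grp_center_metacyclic_iff[OF assms(1-3)] by (auto simp: nc_vertices_def)
  have double: "int m dvd 2 * x \<longleftrightarrow> int h dvd x" for x
    using assms by simp
  have "metacyclic_mult m n u v = metacyclic_mult m n v u \<longleftrightarrow>
      int m dvd (1 - (-1) ^ l) * int i - (1 - (-1) ^ j) * int k"
    using metacyclic_commute_iff[OF in_G] uv by simp
  also have "\<dots> \<longleftrightarrow> metacyclic_part h u = metacyclic_part h v"
  proof (cases "even j"; cases "even l")
    assume "odd j" "odd l"
    then have "int m dvd (1 - (-1) ^ l) * int i - (1 - (-1) ^ j) * int k
        \<longleftrightarrow> int m dvd 2 * (int i - int k)"
      by (simp add: algebra_simps)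
    also have "\<dots> \<longleftrightarrow> i mod h = k mod h"
      unfolding double mod_eq_dvd_iff[symmetric] by (metis of_nat_eq_iff zmod_int)
    finally show ?thesis
      using \<open>odd j\<close> \<open>odd l\<close> uv by (simp add: metacyclic_part_def)
  qed (use nc double in \<open>auto simp: uv metacyclic_part_def\<close>)
  finally show ?thesis
    using assms uv by (auto simp: nc_adj_def)
qed

section \<open>Counting the parts and reading off the spectrum\<close>

lemma card_even_odd_below:
  shows "card {j. j < 2 * n \<and> even j} = n" and "card {j. j < 2 * n \<and> odd j} = n"
proof -
  have "{j. j < 2 * n \<and> even j} = (*) 2 ` {..<n}"
    by (auto elim!: evenE)
  then show "card {j. j < 2 * n \<and> even j} = n"
    by (simp add: card_image inj_on_def)
  have "{j. j < 2 * n \<and> odd j} = (\<lambda>k. 2 * k + 1) ` {..<n}"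
    by (auto elim!: oddE)
  then show "card {j. j < 2 * n \<and> odd j} = n"
    by (simp add: card_image inj_on_def)
qed

lemma residues_below_double:
  fixes h r :: nat
  assumes "r < h"
  shows "{i. i < 2 * h \<and> i mod h = r} = {r, r + h}"
proof -
  have "i = r \<or> i = r + h" if "i < 2 * h" "i mod h = r" for i
    using that by (cases "i < h") (auto simp: mod_if split: if_splits)
  then show ?thesis using assms by auto
qed

theorem theorem6p4:
  fixes m n :: nat
  assumes "m > 2" and "even m" and "n \<ge> 1"
  shows "char_poly (dist_laplacian_mat
            (nc_vertices (metacyclic_carrier m n) (metacyclic_mult m n))
            (nc_adj (metacyclic_carrier m n) (metacyclic_mult m n)))
       = [:0, 1:] ^ 1
         * [:- (2 * real n * (real m - 1)), 1:] ^ (m div 2)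
         * [:- (2 * real m * real n), 1:] ^ ((2 * n - 1) * m div 2)
         * [:- ((3 * real m - 4) * real n), 1:] ^ ((m div 2 - 1) * (2 * n) - 1)"
proof -
  obtain h where m: "m = 2 * h" using \<open>even m\<close> by (rule evenE)
  then have "h > 1" using \<open>m > 2\<close> by simp
  define V where "V = nc_vertices (metacyclic_carrier m n) (metacyclic_mult m n)"
  define c where "c = metacyclic_part h"
  have V: "V = {(i, j). i < m \<and> j < 2 * n \<and> \<not> (even j \<and> h dvd i)}"
    using mem_grp_center_metacyclic_iff[OF m \<open>h > 1\<close> \<open>n \<ge> 1\<close>]
    by (auto simp: V_def nc_vertices_def metacyclic_carrier_def)
  have "finite V"
    by (rule finite_subset[of _ "{..<m} \<times> {..<2 * n}"]) (auto simp: V)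
  have multiples: "{i. i < m \<and> h dvd i} = {0, h}"
    using residues_below_double[of 0 h] \<open>h > 1\<close> by (simp add: m mod_eq_0_iff_dvd)
  have "{v \<in> V. c v = None} = ({..<m} - {0, h}) \<times> {j. j < 2 * n \<and> even j}"
    unfolding multiples[symmetric] by (auto simp: V c_def metacyclic_part_def split: if_splits)
  moreover have "card ({..<m} - {0, h}) = 2 * h - 2"
    using \<open>h > 1\<close> by (simp add: card_Diff_subset m numeral_2_eq_2)
  ultimately have size_None: "class_size V c None = (2 * h - 2) * n"
    by (simp add: class_size_def card_cartesian_product card_even_odd_below)
  have size_Some: "class_size V c (Some r) = 2 * n" if "r < h" for r
  proof -
    have "{v \<in> V. c v = Some r} = {i. i < 2 * h \<and> i mod h = r} \<times> {j. j < 2 * n \<and> odd j}"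
      by (auto simp: V c_def metacyclic_part_def m split: if_splits)
    then show ?thesis
      using residues_below_double[OF that] that
      by (simp add: class_size_def card_cartesian_product card_even_odd_below)
  qed
  have image: "c ` V = insert None (Some ` {..<h})"
  proof
    show "c ` V \<subseteq> insert None (Some ` {..<h})"
      using \<open>h > 1\<close> by (auto simp: c_def metacyclic_part_def split: if_splits)
    \<comment> \<open>Every part is inhabited: \<open>a\<close> is non-central because
      \<open>h > 1\<close>, and \<open>a^r b\<close> represents the part of residue
      \<open>r\<close>.\<close>
    have "None = c (1, 0)" "(1, 0) \<in> V"
      using \<open>h > 1\<close> \<open>n \<ge> 1\<close> by (auto simp: c_def metacyclic_part_def V m)
    moreover have "Some r = c (r, 1)" "(r, 1) \<in> V" if "r < h" for r
      using that \<open>n \<ge> 1\<close> by (auto simp: c_def metacyclic_part_def V m)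
    ultimately show "insert None (Some ` {..<h}) \<subseteq> c ` V"
      by blast
  qed
  \<comment> \<open>One even part and \<open>h\<close> odd parts; the eigenvalue
    \<open>card V\<close> thus gets multiplicity \<open>h = m div 2\<close>.\<close>
  then have card_image: "card (c ` V) = h + 1"
    by (simp add: card_image)
  have "card V = (\<Sum>C\<in>c ` V. class_size V c C)"
    unfolding class_size_def using sum.group[of V "c ` V" c "\<lambda>_. 1 :: nat"] \<open>finite V\<close> by simp
  also have "\<dots> = (2 * h - 2) * n + h * (2 * n)"
    by (simp add: image sum.reindex size_None size_Some)
  finally have card_V: "real (card V) = 2 * real n * (real m - 1)"
    using \<open>h > 1\<close> by (simp add: m of_nat_diff algebra_simps)
  have None_value: "real (card V + (2 * h - 2) * n) = (3 * real m - 4) * real n"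
  proof -
    have "real ((2 * h - 2) * n) = (real m - 2) * real n"
      using \<open>h > 1\<close> by (simp add: m of_nat_diff)
    then show ?thesis
      unfolding of_nat_add by (simp only: card_V) (simp add: algebra_simps)
  qed
  have Some_value: "real (card V + 2 * n) = 2 * real m * real n"
    by (simp add: card_V algebra_simps)
  have "char_poly (dist_laplacian_mat V
      (nc_adj (metacyclic_carrier m n) (metacyclic_mult m n))) =
      [:0, 1:] * [:- real (card V), 1:] ^ (card (c ` V) - 1)
      * (\<Prod>C\<in>c ` V. [:- real (card V + class_size V c C), 1:] ^ (class_size V c C - 1))"
    using nc_adj_metacyclic_iff[OF m \<open>h > 1\<close> \<open>n \<ge> 1\<close>] \<open>h > 1\<close> \<open>finite V\<close> card_image
    unfolding V_def c_def
    by (intro char_poly_dist_laplacian_complete_multipartite) auto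
  \<comment> \<open>The even part supplies the eigenvalue \<open>(3 * m - 4) * n\<close>. The
    \<open>h\<close> odd parts share the eigenvalue \<open>2 * m * n\<close>, each with multiplicity
    \<open>2 * n - 1\<close>.\<close>
  also have "(\<Prod>C\<in>c ` V. [:- real (card V + class_size V c C), 1:] ^ (class_size V c C - 1)) =
      [:- ((3 * real m - 4) * real n), 1:] ^ ((2 * h - 2) * n - 1)
      * ([:- (2 * real m * real n), 1:] ^ (2 * n - 1)) ^ h"
    by (simp add: image prod.reindex None_value Some_value size_None size_Some del: of_nat_add)
  finally have "char_poly (dist_laplacian_mat V
      (nc_adj (metacyclic_carrier m n) (metacyclic_mult m n))) =
      [:0, 1:] * [:- (2 * real n * (real m - 1)), 1:] ^ h
      * ([:- ((3 * real m - 4) * real n), 1:] ^ ((2 * h - 2) * n - 1)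
      * ([:- (2 * real m * real n), 1:] ^ (2 * n - 1)) ^ h)"
    unfolding card_V card_image by simp
  \<comment> \<open>In the stated exponent \<open>div\<close> applies to the whole product
    \<open>(2 * n - 1) * m\<close>; the division is exact because \<open>m = 2 * h\<close>.\<close>
  moreover have "(2 * h - 2) * n - 1 = (m div 2 - 1) * (2 * n) - 1" "(2 * n - 1) * m div 2 = (2 * n - 1) * h"
    by (simp_all add: m algebra_simps)
  ultimately show ?thesis
    unfolding V_def by (simp add: m mult_ac flip: power_mult)
qed

end
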